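(* Let $N\in\{1,2,\dots\}$, $\alpha\in(0,N)$ with $\alpha>N-2$, $V\in C(\mathbb{R}^N;[0,\infty))$ and $a_*\in\mathbb{R}^N$. Assume that, as $x\to a_*$, $$V(x)=o\bigl(|x-a_*|^{\frac{4}{\alpha+2-N}-2}\bigr).$$ Let $\varepsilon_0>0$ and let $(u_\varepsilon)_{\varepsilon\in(0,\varepsilon_0)}$ be a family in $H^1_{\mathrm{loc}}(\mathbb{R}^N)\cap L^2\bigl(\mathbb{R}^N,(1+|x|)^{-(N-\alpha)}\,dx\bigr)$ such that each $u_\varepsilon$ is a positive weak solution of $$-\varepsilon^2\Delta u_\varepsilon+Vu_\varepsilon=\varepsilon^{-\alpha}\bigl(I_\alpha*|u_\varepsilon|^2\bigr)u_\varepsilon\quad\text{in }\mathbb{R}^N.$$ Then for every compact set $K\subset\mathbb{R}^N\setminus\{a_*\}$, as $\varepsilon\to0$, $$\int_K|u_\varepsilon|^2=o(\varepsilon^N).$$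
   Context: The Riesz potential of order $\alpha\in(0,N)$ is $I_\alpha(x)=\dfrac{\Gamma(\frac{N-\alpha}{2})}{\Gamma(\frac{\alpha}{2})\pi^{N/2}2^\alpha|x|^{N-\alpha}}$ for $x\ne0$. Weak solution means that the right-hand side of the equation is locally integrable and $\int_{\mathbb{R}^N}\varepsilon^2\nabla u\cdot\nabla\varphi+Vu\varphi=\varepsilon^{-\alpha}\int_{\mathbb{R}^N}(I_\alpha*|u|^2)u\varphi$ for all $\varphi\in C^\infty_c(\mathbb{R}^N)$. *)

theory Defs
  imports "HOL-Analysis.Analysis" "HOL-Library.Landau_Symbols"
begin

text \<open>
  The space \<open>\<real>\<^sup>N\<close> is an arbitrary type \<open>'a\<close> of class \<open>euclidean_space\<close>, with \<open>N = DIM('a)\<close>, which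
  is at least 1.  Functions are Lebesgue measurable representatives; all notions below that involve
  integration are invariant under modification on a null set.
\<close>

primrec continuously_differentiable :: "nat \<Rightarrow> ('a::euclidean_space \<Rightarrow> real) \<Rightarrow> bool" where
  "continuously_differentiable 0 f \<longleftrightarrow> continuous_on UNIV f"
| "continuously_differentiable (Suc k) f \<longleftrightarrow>
     f differentiable_on UNIV \<and>
     (\<forall>b\<in>Basis. continuously_differentiable k (\<lambda>x. frechet_derivative f (at x) b))"

definition test_function :: "('a::euclidean_space \<Rightarrow> real) \<Rightarrow> bool" where
  "test_function \<phi> \<longleftrightarrow>
     (\<forall>k. continuously_differentiable k \<phi>) \<and> compact (closure {x. \<phi> x \<noteq> 0})"

definition grad :: "('a::euclidean_space \<Rightarrow> real) \<Rightarrow> 'a \<Rightarrow> 'a" where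
  "grad f x = (\<Sum>b\<in>Basis. frechet_derivative f (at x) b *\<^sub>R b)"

definition locally_integrable ::
    "('a::euclidean_space \<Rightarrow> 'b::euclidean_space) \<Rightarrow> bool" where
  "locally_integrable f \<longleftrightarrow> (\<forall>K. compact K \<longrightarrow> set_integrable lebesgue K f)"

definition locally_square_integrable ::
    "('a::euclidean_space \<Rightarrow> 'b::euclidean_space) \<Rightarrow> bool" where
  "locally_square_integrable f \<longleftrightarrow>
     f \<in> borel_measurable lebesgue \<and> locally_integrable (\<lambda>x. (norm (f x))\<^sup>2)"

definition has_weak_gradient ::
    "('a::euclidean_space \<Rightarrow> real) \<Rightarrow> ('a \<Rightarrow> 'a) \<Rightarrow> bool" where
  "has_weak_gradient u g \<longleftrightarrow>
     locally_integrable u \<and> locally_integrable g \<and>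
     (\<forall>\<phi>. test_function \<phi> \<longrightarrow>
        (\<integral>x. u x *\<^sub>R grad \<phi> x \<partial>lebesgue) = - (\<integral>x. \<phi> x *\<^sub>R g x \<partial>lebesgue))"

text \<open>Weak gradients are unique up to null sets, so the choice of representative is immaterial.\<close>

definition weak_grad :: "('a::euclidean_space \<Rightarrow> real) \<Rightarrow> 'a \<Rightarrow> 'a" where
  "weak_grad u = (SOME g. has_weak_gradient u g)"

definition H1_loc :: "('a::euclidean_space \<Rightarrow> real) set" where
  "H1_loc = {u. locally_square_integrable u \<and> (\<exists>g. has_weak_gradient u g) \<and>
                locally_square_integrable (weak_grad u)}"

definition weighted_L2 :: "('a::euclidean_space \<Rightarrow> real) \<Rightarrow> ('a \<Rightarrow> real) set" where
  "weighted_L2 w = {u. u \<in> borel_measurable lebesgue \<and>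
                       integrable lebesgue (\<lambda>x. \<bar>u x\<bar>\<^sup>2 * w x)}"

text \<open>At the origin, division by zero assigns the kernel the value 0.\<close>

definition riesz_kernel :: "real \<Rightarrow> 'a::euclidean_space \<Rightarrow> real" where
  "riesz_kernel \<alpha> x =
     Gamma ((real DIM('a) - \<alpha>) / 2) /
       (Gamma (\<alpha> / 2) * pi powr (real DIM('a) / 2) * 2 powr \<alpha> *
        norm x powr (real DIM('a) - \<alpha>))"

text \<open>
  The Bochner integral is 0 where the integrand is not integrable. For
  \<open>f = \<bar>u\<bar>\<^sup>2\<close>, with \<open>u\<close> square integrable with respect to the weight
  \<open>(1 + \<bar>x\<bar>)\<close> to the power \<open>-(N - \<alpha>)\<close>, this concerns only a null set of points.
\<close>

definition riesz_potential :: "real \<Rightarrow> ('a::euclidean_space \<Rightarrow> real) \<Rightarrow> 'a \<Rightarrow> real" where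
  "riesz_potential \<alpha> f x = (\<integral>y. riesz_kernel \<alpha> (x - y) * f y \<partial>lebesgue)"

definition weak_solution ::
    "real \<Rightarrow> ('a::euclidean_space \<Rightarrow> real) \<Rightarrow> real \<Rightarrow> ('a \<Rightarrow> real) \<Rightarrow> bool" where
  "weak_solution \<alpha> V \<epsilon> u \<longleftrightarrow>
     locally_integrable (\<lambda>x. \<epsilon> powr (- \<alpha>) * (riesz_potential \<alpha> (\<lambda>y. \<bar>u y\<bar>\<^sup>2) x * u x)) \<and>
     (\<forall>\<phi>. test_function \<phi> \<longrightarrow>
        (\<integral>x. \<epsilon>\<^sup>2 * (weak_grad u x \<bullet> grad \<phi> x) + V x * u x * \<phi> x \<partial>lebesgue) =
        \<epsilon> powr (- \<alpha>) * (\<integral>x. riesz_potential \<alpha> (\<lambda>y. \<bar>u y\<bar>\<^sup>2) x * u x * \<phi> x \<partial>lebesgue))"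

definition positive_weak_solution ::
    "real \<Rightarrow> ('a::euclidean_space \<Rightarrow> real) \<Rightarrow> real \<Rightarrow> ('a \<Rightarrow> real) \<Rightarrow> bool" where
  "positive_weak_solution \<alpha> V \<epsilon> u \<longleftrightarrow>
     weak_solution \<alpha> V \<epsilon> u \<and> (AE x in lebesgue. u x > 0)"

end

theory Submission
  imports Defs
begin

text \<open>
  Let \<open>\<phi>(x) = exp (-1 / (1 - \<bar>x - a\<bar>\<^sup>2 / r\<^sup>2))\<close> on the ball of radius \<open>r\<close> around \<open>a\<close> and 0 outside.
  It is a test function with \<open>-\<Delta>\<phi> \<le> (\<Lambda> / r\<^sup>2) \<phi>\<close>, where \<open>\<Lambda>\<close> depends only on the dimension \<open>N\<close>.
  Near \<open>a\<close> the Riesz potential of \<open>\<bar>u\<bar>\<^sup>2\<close> is at least \<open>C M\<close>, where \<open>M\<close> is the integral of \<open>\<bar>u\<bar>\<^sup>2\<close>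
  over \<open>K\<close>. Testing the equation with \<open>\<phi>\<close>, moving all derivatives to \<open>\<phi>\<close> and dividing by the
  integral of \<open>u \<phi>\<close>, which is positive, gives \<open>\<epsilon> powr (-\<alpha>) * C M \<le> \<epsilon>\<^sup>2 \<Lambda> / r\<^sup>2 + sup V\<close>, with the
  supremum over the ball. Choose \<open>r\<close> as a large multiple of \<open>\<epsilon>\<close> to the power \<open>(\<alpha> + 2 - N) / 2\<close>:
  the first term becomes a small multiple of \<open>\<epsilon>\<close> to the power \<open>N - \<alpha>\<close>, and by the assumption on
  \<open>V\<close> so does the second.
\<close>

section \<open>A smooth bump function\<close>

text \<open>The index \<open>k\<close> makes the family closed under differentiation: the derivative
  of each member is a linear combination of members. All of them vanish for
  \<open>t \<le> 0\<close>.\<close>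

definition flat_exp :: "nat \<Rightarrow> real \<Rightarrow> real" where
  "flat_exp k t = (if t \<le> 0 then 0 else exp (- (1 / t)) / t ^ k)"

text \<open>Under the substitution s = 1/t the right-hand limit says that the exponential beats
  every power at infinity. This is what yields the derivative at the origin in the next
  lemma.\<close>

lemma flat_exp_tendsto_0: "flat_exp k \<midarrow>0\<rightarrow> 0"
proof -
  have "((\<lambda>s. s ^ k / exp s) \<longlongrightarrow> (0::real)) at_top"
    by (rule tendsto_power_div_exp_0)
  then have "((\<lambda>t. inverse t ^ k / exp (inverse t)) \<longlongrightarrow> (0::real)) (at_right 0)"
    by (rule filterlim_compose) (rule filterlim_inverse_at_top_right)
  moreover have "eventually (\<lambda>t::real. inverse t ^ k / exp (inverse t) = flat_exp k t) (at_right 0)"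
    using eventually_at_right_less
    by eventually_elim (auto simp: flat_exp_def exp_minus field_simps)
  ultimately have "(flat_exp k \<longlongrightarrow> 0) (at_right 0)"
    using tendsto_cong by force
  moreover have "(flat_exp k \<longlongrightarrow> 0) (at_left 0)"
  proof (rule tendsto_eventually)
    show "eventually (\<lambda>t. flat_exp k t = 0) (at_left 0)"
      by (auto simp: flat_exp_def eventually_at intro!: exI[of _ 1])
  qed
  ultimately show ?thesis
    by (simp add: filterlim_split_at)
qed

lemma flat_exp_DERIV:
  "(flat_exp k has_field_derivative (flat_exp (k + 2) t - real k * flat_exp (k + 1) t)) (at t)"
proof -
  consider "t < 0" | "t = 0" | "t > 0" by linarith
  then show ?thesis
  proof cases
    case 1
    have "((\<lambda>_. 0) has_field_derivative (0::real)) (at t)" by simp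
    then have "(flat_exp k has_field_derivative 0) (at t)"
      by (rule DERIV_cong_ev[THEN iffD1, rotated -1])
        (use 1 in \<open>auto simp: flat_exp_def eventually_nhds intro!: exI[of _ "{..<0}"]\<close>)
    then show ?thesis using 1 by (simp add: flat_exp_def)
  next
    case 2
    \<comment> \<open>For nonzero \<open>h\<close> the difference quotient at 0 is exactly
      \<open>flat_exp (Suc k) h\<close>, because \<open>flat_exp k 0 = 0\<close>.\<close>
    have "((\<lambda>h. (flat_exp k (0 + h) - flat_exp k 0) / h) \<longlongrightarrow> 0) (at 0)"
    proof (rule tendsto_cong[THEN iffD1])
      show "flat_exp (Suc k) \<midarrow>0\<rightarrow> 0" by (rule flat_exp_tendsto_0)
      show "eventually (\<lambda>h. flat_exp (Suc k) h = (flat_exp k (0 + h) - flat_exp k 0) / h) (at 0)"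
        by (auto simp: flat_exp_def eventually_at field_simps intro!: exI[of _ 1])
    qed
    then show ?thesis using 2 by (simp add: DERIV_def flat_exp_def)
  next
    case 3
    have e: "((\<lambda>t. exp (- (1 / t)) / t ^ k) has_field_derivative
            (flat_exp (k + 2) t - real k * flat_exp (k + 1) t)) (at t)"
      using 3
      apply (auto intro!: derivative_eq_intros simp: flat_exp_def)
      apply (cases k)
       apply (auto simp: field_simps power2_eq_square)
      done
    show ?thesis
      by (rule DERIV_cong_ev[THEN iffD1, OF refl _ refl e])
        (use 3 in \<open>auto simp: flat_exp_def eventually_nhds intro!: exI[of _ "{0<..}"]\<close>)
  qed
qed

text \<open>An algebra of functions that contains the bump and is stable under directional
  derivatives. Smoothness then follows by induction on the order, without a formula for higher
  derivatives.\<close>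

inductive_set bump_algebra :: "'a::euclidean_space \<Rightarrow> real \<Rightarrow> ('a \<Rightarrow> real) set" for a r where
  const: "(\<lambda>_. c) \<in> bump_algebra a r"
| coord: "(\<lambda>x. x \<bullet> b) \<in> bump_algebra a r"
| flat: "(\<lambda>x. flat_exp k (1 - (norm (x - a))\<^sup>2 / r\<^sup>2)) \<in> bump_algebra a r"
| add: "f \<in> bump_algebra a r \<Longrightarrow> g \<in> bump_algebra a r \<Longrightarrow> (\<lambda>x. f x + g x) \<in> bump_algebra a r"
| mult: "f \<in> bump_algebra a r \<Longrightarrow> g \<in> bump_algebra a r \<Longrightarrow> (\<lambda>x. f x * g x) \<in> bump_algebra a r"

lemma flat_exp_radial_has_derivative:
  fixes a x :: "'a::euclidean_space"
  shows "((\<lambda>x. flat_exp k (1 - (norm (x - a))\<^sup>2 / r\<^sup>2)) has_derivative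
    (\<lambda>h. (flat_exp (k + 2) (1 - (norm (x - a))\<^sup>2 / r\<^sup>2) -
          real k * flat_exp (k + 1) (1 - (norm (x - a))\<^sup>2 / r\<^sup>2)) * (- (2 / r\<^sup>2) * ((x - a) \<bullet> h)))) (at x)"
proof -
  have "((\<lambda>x. 1 - (norm (x - a))\<^sup>2 / r\<^sup>2) has_derivative (\<lambda>h. - (2 / r\<^sup>2) * ((x - a) \<bullet> h))) (at x)"
    unfolding power2_norm_eq_inner divide_inverse
    by (auto intro!: derivative_eq_intros simp: inner_commute)
  from has_derivative_compose[OF this flat_exp_DERIV[of k, unfolded has_field_derivative_def]]
  show ?thesis by simp
qed

lemma bump_algebra_has_derivative:
  assumes "f \<in> bump_algebra a r"
  shows "\<exists>D. (\<forall>x. (f has_derivative D x) (at x)) \<and> (\<forall>b. (\<lambda>x. D x b) \<in> bump_algebra a r)"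
  using assms
proof induction
  case (const c)
  show ?case
    by (rule exI[of _ "\<lambda>_ _. 0"]) (auto intro: bump_algebra.const)
next
  case (coord b)
  show ?case
    by (rule exI[of _ "\<lambda>x h. h \<bullet> b"]) (auto intro!: bump_algebra.const derivative_eq_intros)
next
  case (flat k)
  \<comment> \<open>The derivative is rewritten with sums only, and with the inner product with
    \<open>x - a\<close> split into a linear and a constant term, so that it matches the generating
    rules literally.\<close>
  have "(\<lambda>x. (flat_exp (k + 2) (1 - (norm (x - a))\<^sup>2 / r\<^sup>2) +
          (- real k) * flat_exp (k + 1) (1 - (norm (x - a))\<^sup>2 / r\<^sup>2)) *
          (- (2 / r\<^sup>2) * ((x \<bullet> h) + (- (a \<bullet> h))))) \<in> bump_algebra a r" for h
    by (intro bump_algebra.intros)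
  then show ?case
    by (intro exI[of _ "\<lambda>x h. (flat_exp (k + 2) (1 - (norm (x - a))\<^sup>2 / r\<^sup>2) -
          real k * flat_exp (k + 1) (1 - (norm (x - a))\<^sup>2 / r\<^sup>2)) * (- (2 / r\<^sup>2) * ((x - a) \<bullet> h))"]
        conjI allI flat_exp_radial_has_derivative)
      (simp add: inner_diff_left)
next
  case (add f g)
  then obtain D E where
    "\<And>x. (f has_derivative D x) (at x)" "\<And>b. (\<lambda>x. D x b) \<in> bump_algebra a r"
    "\<And>x. (g has_derivative E x) (at x)" "\<And>b. (\<lambda>x. E x b) \<in> bump_algebra a r"
    by blast
  then show ?case
    by (intro exI[of _ "\<lambda>x h. D x h + E x h"]) (auto intro: has_derivative_add bump_algebra.add)
next
  case (mult f g)
  then obtain D E where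
    "\<And>x. (f has_derivative D x) (at x)" "\<And>b. (\<lambda>x. D x b) \<in> bump_algebra a r"
    "\<And>x. (g has_derivative E x) (at x)" "\<And>b. (\<lambda>x. E x b) \<in> bump_algebra a r"
    by blast
  then show ?case using mult.hyps
    by (intro exI[of _ "\<lambda>x h. f x * E x h + D x h * g x"])
      (auto intro!: has_derivative_mult bump_algebra.intros)
qed

lemma bump_algebra_continuously_differentiable:
  "f \<in> bump_algebra a r \<Longrightarrow> continuously_differentiable k f"
proof (induction k arbitrary: f)
  case 0
  from bump_algebra_has_derivative[OF 0] show ?case
    by (auto intro!: continuous_at_imp_continuous_on intro: has_derivative_continuous)
next
  case (Suc k)
  from bump_algebra_has_derivative[OF Suc.prems] obtain D where
    D: "\<And>x. (f has_derivative D x) (at x)" "\<And>b. (\<lambda>x. D x b) \<in> bump_algebra a r" by blast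
  moreover have "frechet_derivative f (at x) = D x" for x
    using frechet_derivative_at[OF D(1)] by simp
  moreover have "f differentiable_on UNIV"
    using D(1) by (auto simp: differentiable_on_def differentiable_def)
  ultimately show ?case using Suc.IH by simp
qed

definition bump :: "'a::euclidean_space \<Rightarrow> real \<Rightarrow> 'a \<Rightarrow> real" where
  "bump a r x = flat_exp 0 (1 - (norm (x - a))\<^sup>2 / r\<^sup>2)"

lemma bump_nonneg: "bump a r x \<ge> 0"
  by (simp add: bump_def flat_exp_def)

lemma bump_pos_iff: "r > 0 \<Longrightarrow> bump a r x > 0 \<longleftrightarrow> x \<in> ball a r"
  using power2_le_iff_abs_le[of "norm (x - a)" r] abs_square_le_1[of "norm (x - a) / r"]
  by (auto simp: bump_def flat_exp_def divide_simps dist_norm norm_minus_commute not_less)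

lemma bump_test_function:
  assumes "r > 0"
  shows "test_function (bump a r)"
proof -
  have "bump a r \<in> bump_algebra a r"
    using bump_algebra.flat[of 0 a r] by (simp add: bump_def[abs_def])
  moreover have "{x. bump a r x \<noteq> 0} \<subseteq> cball a r"
    using bump_pos_iff[OF assms, of a] bump_nonneg[of a r] by (auto simp: less_le)
  then have "closure {x. bump a r x \<noteq> 0} \<subseteq> cball a r"
    by (intro closure_minimal) auto
  then have "compact (closure {x. bump a r x \<noteq> 0})"
    using compact_Int_closed[OF compact_cball closed_closure] by (metis Int_absorb1)
  ultimately show ?thesis
    by (auto simp: test_function_def intro: bump_algebra_continuously_differentiable)
qed

section \<open>Partial derivatives and the Laplacian of the bump\<close>

definition partial :: "'a::euclidean_space \<Rightarrow> ('a \<Rightarrow> real) \<Rightarrow> 'a \<Rightarrow> real" where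
  "partial b f x = frechet_derivative f (at x) b"

text \<open>Allows the components of the gradient of a test function to serve as test functions
  themselves. Off the closed support \<open>f\<close> vanishes on an open set, so its derivative is
  0 there.\<close>

lemma test_function_partial:
  assumes "test_function f" "b \<in> Basis"
  shows "test_function (partial b f)"
proof -
  let ?C = "closure {x. f x \<noteq> 0}"
  have "continuously_differentiable k (partial b f)" for k
  proof -
    have "continuously_differentiable (Suc k) f" using assms by (auto simp: test_function_def)
    then show ?thesis using assms by (simp add: partial_def[abs_def])
  qed
  moreover have "partial b f x = 0" if "x \<notin> ?C" for x
  proof -
    have z: "((\<lambda>_. 0) has_derivative (\<lambda>_. 0)) (at x)" by simp
    have "(f has_derivative (\<lambda>_. 0)) (at x)"
    proof (rule has_derivative_transform_within_open[OF z])
      show "open (- ?C)" "x \<in> - ?C" using that by auto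
      show "\<And>y. y \<in> - ?C \<Longrightarrow> 0 = f y" using closure_subset[of "{x. f x \<noteq> 0}"] by auto
    qed
    then show ?thesis unfolding partial_def using frechet_derivative_at[of f "\<lambda>_. 0" x] by metis
  qed
  then have "{x. partial b f x \<noteq> 0} \<subseteq> ?C" by auto
  then have "closure {x. partial b f x \<noteq> 0} \<subseteq> ?C" by (intro closure_minimal) auto
  then have "compact (closure {x. partial b f x \<noteq> 0})"
    using assms(1) compact_Int_closed[OF _ closed_closure] unfolding test_function_def
    by (metis Int_absorb1)
  ultimately show ?thesis by (simp add: test_function_def)
qed

text \<open>The chain rule for F(s) with F = \<open>flat_exp 0\<close>: the Laplacian is F''(s)
  times the squared gradient of s, which is \<open>4 / r\<^sup>2 * (1 - s)\<close>, plus F'(s) times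
  the Laplacian of s, which is \<open>- 2 * DIM('a) / r\<^sup>2\<close>. Here F' =
  \<open>flat_exp 2\<close> and F'' = \<open>flat_exp 4\<close> - 2
  \<open>flat_exp 3\<close>.\<close>

lemma bump_laplacian:
  fixes a x :: "'a::euclidean_space" and r :: real
  defines "s \<equiv> 1 - (norm (x - a))\<^sup>2 / r\<^sup>2"
  assumes r: "r > 0"
  shows "(\<Sum>b\<in>Basis. partial b (partial b (bump a r)) x) =
    4 / r\<^sup>2 * (1 - s) * (flat_exp 4 s - 2 * flat_exp 3 s) - 2 * DIM('a) / r\<^sup>2 * flat_exp 2 s"
proof -
  let ?s = "\<lambda>x. 1 - (norm (x - a))\<^sup>2 / r\<^sup>2"
  have p1: "partial b (bump a r) = (\<lambda>x. flat_exp 2 (?s x) * (- (2 / r\<^sup>2) * ((x - a) \<bullet> b)))" for b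
    unfolding partial_def bump_def[abs_def]
    using frechet_derivative_at[OF flat_exp_radial_has_derivative[of 0 a r], symmetric]
    by (simp add: numeral_2_eq_2)
  have p2: "partial b (partial b (bump a r)) x =
      flat_exp 2 s * (- (2 / r\<^sup>2)) +
      (flat_exp 4 s - 2 * flat_exp 3 s) * (4 / r\<^sup>2 / r\<^sup>2) * ((x - a) \<bullet> b)\<^sup>2" if "b \<in> Basis" for b
  proof -
    have l: "((\<lambda>x. - (2 / r\<^sup>2) * ((x - a) \<bullet> b)) has_derivative (\<lambda>h. - (2 / r\<^sup>2) * (h \<bullet> b))) (at x)"
      by (intro has_derivative_mult_right has_derivative_inner_left) (auto intro!: derivative_eq_intros)
    have e: "((\<lambda>x. flat_exp 2 (?s x)) has_derivative
       (\<lambda>h. (flat_exp 4 (?s x) - 2 * flat_exp 3 (?s x)) * (- (2 / r\<^sup>2) * ((x - a) \<bullet> h)))) (at x)"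
      using flat_exp_radial_has_derivative[of 2 a r x] by simp
    have "(partial b (bump a r) has_derivative (\<lambda>h.
       flat_exp 2 (?s x) * (- (2 / r\<^sup>2) * (h \<bullet> b)) +
       ((flat_exp 4 (?s x) - 2 * flat_exp 3 (?s x)) * (- (2 / r\<^sup>2) * ((x - a) \<bullet> h))) *
       (- (2 / r\<^sup>2) * ((x - a) \<bullet> b)))) (at x)"
      unfolding p1 by (rule has_derivative_mult[OF e l])
    then have "frechet_derivative (partial b (bump a r)) (at x) b = 
       flat_exp 2 (?s x) * (- (2 / r\<^sup>2) * (b \<bullet> b)) +
       ((flat_exp 4 (?s x) - 2 * flat_exp 3 (?s x)) * (- (2 / r\<^sup>2) * ((x - a) \<bullet> b))) *
       (- (2 / r\<^sup>2) * ((x - a) \<bullet> b))"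
      by (simp only: frechet_derivative_at[symmetric])
    then show ?thesis using that
      by (simp add: partial_def s_def power2_eq_square field_simps)
  qed
  have "(\<Sum>b\<in>Basis. ((x - a) \<bullet> b)\<^sup>2) = (norm (x - a))\<^sup>2"
    by (subst power2_norm_eq_inner, subst euclidean_inner) (simp add: power2_eq_square)
  also have "\<dots> = r\<^sup>2 * (1 - s)" using r by (simp add: s_def)
  finally have sq: "(\<Sum>b\<in>Basis. ((x - a) \<bullet> b)\<^sup>2) = r\<^sup>2 * (1 - s)" .
  have sum: "(\<Sum>b\<in>Basis. partial b (partial b (bump a r)) x) =
      DIM('a) * (flat_exp 2 s * (- (2 / r\<^sup>2))) +
      (flat_exp 4 s - 2 * flat_exp 3 s) * (4 / r\<^sup>2 / r\<^sup>2) * (\<Sum>b\<in>Basis. ((x - a) \<bullet> b)\<^sup>2)"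
    by (simp only: sum.cong[OF refl p2] sum.distrib sum_distrib_left[symmetric] sum_constant)
      (simp only: mult_ac)
  have factor: "P * (4 / r\<^sup>2 / r\<^sup>2) * (r\<^sup>2 * (1 - s)) = 4 / r\<^sup>2 * (1 - s) * P" for P
    using r by (simp add: field_simps)
  show ?thesis unfolding sum sq factor by simp
qed

text \<open>With \<open>s = 1 - \<bar>x - a\<bar>\<^sup>2 / r\<^sup>2\<close>, the term of order \<open>s\<close> to the power \<open>-4\<close> dominates near
  the boundary of the ball and makes the Laplacian positive there; elsewhere \<open>s\<close> is bounded
  below.\<close>

lemma bump_laplacian_ge:
  fixes a x :: "'a::euclidean_space" and r :: real
  assumes r: "r > 0"
  defines "n \<equiv> real DIM('a)"
  shows "(\<Sum>b\<in>Basis. partial b (partial b (bump a r)) x) \<ge> - ((2 * n + 1) * (n + 6) ^ 4 / r\<^sup>2) * bump a r x"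
proof -
  define s where "s = 1 - (norm (x - a))\<^sup>2 / r\<^sup>2"
  define L where "L = (2 * n + 1) * (n + 6) ^ 4"
  have s1: "s \<le> 1" by (simp add: s_def)
  have n: "n \<ge> 1" using DIM_positive[where 'a='a] by (simp add: n_def Suc_le_eq)
  have "0 \<le> 4 * (1 - s) * (flat_exp 4 s - 2 * flat_exp 3 s) - 2 * n * flat_exp 2 s + L * flat_exp 0 s"
  proof (cases "s \<le> 0")
    case True
    then show ?thesis by (simp add: flat_exp_def)
  next
    case False
    then have s0: "s > 0" by simp
    \<comment> \<open>Dividing out the positive factor \<open>exp (- (1 / s)) / s ^ 4\<close> leaves
      a polynomial inequality.\<close>
    have "0 \<le> 4 * (1 - s) * (1 - 2 * s) - 2 * n * s\<^sup>2 + L * s ^ 4"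
    \<comment> \<open>Below the threshold, \<open>12 * s + 2 * n * s \<le> 2\<close>, so the
      constant term 4 wins. Above it, \<open>L * s ^ 4 \<ge> 2 * n + 1\<close>, which outweighs
      \<open>2 * n\<close> and the minimum -1/2 of the quadratic, attained at s = 3/4.\<close>
    proof (cases "s \<le> 1 / (n + 6)")
      case True
      then have "s * (n + 6) \<le> 1" using n by (simp add: field_simps)
      moreover have "n * s\<^sup>2 \<le> n * s"
        using s0 s1 n by (simp add: power2_eq_square mult_left_le)
      moreover have "L * s ^ 4 \<ge> 0" using n by (simp add: L_def)
      moreover have "4 * (1 - s) * (1 - 2 * s) = 4 - 12 * s + 8 * s\<^sup>2" "s\<^sup>2 \<ge> 0" "s * (n + 6) = n * s + 6 * s"
        by (simp_all add: power2_eq_square algebra_simps)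
      ultimately show ?thesis by linarith
    next
      case F: False
      then have "s * (n + 6) \<ge> 1" using n by (simp add: field_simps)
      then have "(s * (n + 6)) ^ 4 \<ge> 1" by (rule one_le_power)
      then have "L * s ^ 4 \<ge> 2 * n + 1"
        using mult_left_mono[of 1 "(s * (n + 6)) ^ 4" "2 * n + 1"] n
        by (simp add: L_def power_mult_distrib mult_ac)
      moreover have "n * s\<^sup>2 \<le> n" using s0 s1 n by (simp add: power_le_one mult_left_le)
      moreover have "4 * (1 - s) * (1 - 2 * s) = 8 * (s - 3/4)\<^sup>2 - 1/2"
        by (simp add: power2_eq_square algebra_simps)
      moreover have "8 * (s - 3/4)\<^sup>2 \<ge> 0" by simp
      ultimately show ?thesis by linarith
    qed
    then have "0 \<le> (4 * (1 - s) * (1 - 2 * s) - 2 * n * s\<^sup>2 + L * s ^ 4) * (exp (- (1 / s)) / s ^ 4)"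
      using s0 by simp
    also have "\<dots> = 4 * (1 - s) * (flat_exp 4 s - 2 * flat_exp 3 s) - 2 * n * flat_exp 2 s + L * flat_exp 0 s"
      using s0 by (simp add: flat_exp_def divide_simps) (simp add: power_numeral_reduce algebra_simps)
    finally show ?thesis .
  qed
  then have "0 \<le> (4 * (1 - s) * (flat_exp 4 s - 2 * flat_exp 3 s) - 2 * n * flat_exp 2 s + L * flat_exp 0 s) / r\<^sup>2"
    by simp
  moreover have "(4 * (1 - s) * P - 2 * n * Q + L * E) / k = 4 / k * (1 - s) * P - 2 * n / k * Q + L / k * E"
    for P Q E k :: real
    by (simp add: divide_inverse algebra_simps)
  ultimately show ?thesis
    unfolding bump_laplacian[OF r] bump_def s_def[symmetric] L_def[symmetric]
    by (simp only: n_def of_nat_mult of_nat_numeral)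
qed

section \<open>A lower bound for Riesz potentials\<close>

text \<open>The kernel is dominated by its values on dyadic balls, whose contributions form a geometric
  series.\<close>

lemma nn_integral_norm_powr_ball_finite:
  fixes s R :: real
  assumes "0 < s" "s < DIM('a)" "R > 0"
  shows "(\<integral>\<^sup>+ x. ennreal (1 / norm x powr s) * indicator (ball (0::'a::euclidean_space) R) x \<partial>lborel) < \<infinity>"
proof -
  let ?B = "\<lambda>k. ball (0::'a) (R / 2 ^ k)"
  let ?c = "\<lambda>k::nat. (2 ^ Suc k / R) powr s"
  define \<omega> where "\<omega> = measure lborel (ball (0::'a) 1)"
  \<comment> \<open>The ratio of the geometric series: from one ball to the next the kernel bound
    grows by \<open>2 powr s\<close> while the volume shrinks by \<open>2 ^ DIM('a)\<close>.\<close>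
  define q where "q = 2 powr s / 2 ^ DIM('a)"
  have le: "f k \<le> (\<Sum>k. f k)" for f :: "nat \<Rightarrow> ennreal" and k
    using sum_le_suminf[OF summableI, of "{k}" f] by simp
  have dyadic: "ennreal (1 / norm x powr s) * indicator (ball 0 R) x \<le> (\<Sum>k. ennreal (?c k) * indicator (?B k) x)" for x :: 'a
  \<comment> \<open>At \<open>x = 0\<close> the left side is 0, since \<open>0 powr s = 0\<close>
    and division by zero gives 0.\<close>
  proof (cases "x \<noteq> 0 \<and> norm x < R")
    case True
    then have "norm x / R > 0" using assms by simp
    then obtain n0 where "(1/2) ^ n0 < norm x / R" using real_arch_pow_inv[of "norm x / R" "1/2"] by auto
    \<comment> \<open>The predecessor \<open>k\<close> of the least such \<open>n\<close> locates
      \<open>x\<close> in the dyadic shell between radii \<open>R / 2 ^ Suc k\<close> and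
      \<open>R / 2 ^ k\<close>.\<close>
    define n where "n = (LEAST n. (1/2::real) ^ n \<le> norm x / R)"
    have n: "(1/2::real) ^ n \<le> norm x / R"
      unfolding n_def by (rule LeastI[of _ n0]) (use \<open>(1/2) ^ n0 < norm x / R\<close> in simp)
    have "norm x / R < 1" using True assms by simp
    then have "n \<noteq> 0" using n by (cases n) auto
    then obtain k where k: "n = Suc k" using not0_implies_Suc by blast
    have "\<not> (1/2::real) ^ k \<le> norm x / R"
      using k unfolding n_def by (intro not_less_Least) simp
    then have "norm x < R / 2 ^ k" using assms by (simp add: field_simps)
    moreover have "1 / norm x \<le> 2 ^ Suc k / R"
      using n k True assms by (simp add: field_simps)
    then have "(1 / norm x) powr s \<le> ?c k"
      using assms by (intro powr_mono2) auto
    then have "1 / norm x powr s \<le> ?c k"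
      by (simp add: powr_divide)
    ultimately have "ennreal (1 / norm x powr s) * indicator (ball 0 R) x \<le> ennreal (?c k) * indicator (?B k) x"
      using True by (simp add: ennreal_leI)
    also have "\<dots> \<le> (\<Sum>k. ennreal (?c k) * indicator (?B k) x)"
      by (rule le)
    finally show ?thesis .
  qed auto
  have "(\<integral>\<^sup>+ x. ennreal (1 / norm x powr s) * indicator (ball (0::'a) R) x \<partial>lborel)
      \<le> (\<integral>\<^sup>+ x. (\<Sum>k. ennreal (?c k) * indicator (?B k) x) \<partial>lborel)"
    by (intro nn_integral_mono dyadic)
  also have "\<dots> = (\<Sum>k. \<integral>\<^sup>+ x. ennreal (?c k) * indicator (?B k) x \<partial>lborel)"
    by (rule nn_integral_suminf)
      (intro borel_measurable_times_ennreal borel_measurable_const borel_measurable_indicator; simp)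
  also have "\<dots> = (\<Sum>k. ennreal ((2 / R) powr s * R ^ DIM('a) * \<omega> * q ^ k))"
  proof (intro suminf_cong)
    fix k
    have "emeasure lborel (?B k) = ennreal ((R / 2 ^ k) ^ DIM('a) * \<omega>)"
      using content_ball_conv_unit_ball[of "R / 2 ^ k" "0::'a"] emeasure_lborel_ball_finite[of "0::'a" "R / 2 ^ k"] assms
      by (simp add: emeasure_eq_ennreal_measure \<omega>_def)
    then have "(\<integral>\<^sup>+ x. ennreal (?c k) * indicator (?B k) x \<partial>lborel) = ennreal (?c k * ((R / 2 ^ k) ^ DIM('a) * \<omega>))"
      by (simp add: nn_integral_cmult_indicator ennreal_mult'' \<omega>_def assms less_imp_le)
    also have "?c k * ((R / 2 ^ k) ^ DIM('a) * \<omega>) = (2 / R) powr s * (2 powr s) ^ k * ((R / 2 ^ k) ^ DIM('a) * \<omega>)"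
    proof -
      have "?c k = (2 / R * 2 ^ k) powr s" by (simp add: field_simps)
      also have "\<dots> = (2 / R) powr s * (2 ^ k) powr s" using assms by (intro powr_mult) 
      also have "(2 ^ k :: real) powr s = (2 powr s) ^ k"
        by (simp add: powr_powr mult.commute flip: powr_realpow)
      finally show ?thesis by simp
    qed
    also have "(2 / R) powr s * (2 powr s) ^ k * ((R / 2 ^ k) ^ DIM('a) * \<omega>) = (2 / R) powr s * R ^ DIM('a) * \<omega> * q ^ k"
      by (simp add: q_def power_divide power_mult[symmetric] mult.commute)
    finally show "(\<integral>\<^sup>+ x. ennreal (?c k) * indicator (?B k) x \<partial>lborel) = ennreal ((2 / R) powr s * R ^ DIM('a) * \<omega> * q ^ k)" .
  qed
  also have "\<dots> < \<infinity>"
  proof -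
    have "2 powr s < 2 powr real DIM('a)" using assms by (intro powr_less_mono) auto
    then have "q < 1" "q \<ge> 0" by (simp_all add: q_def powr_realpow)
    then have "summable (\<lambda>k. (2 / R) powr s * R ^ DIM('a) * \<omega> * q ^ k)"
      by (intro summable_mult summable_geometric) auto
    then have "(\<Sum>k. ennreal ((2 / R) powr s * R ^ DIM('a) * \<omega> * q ^ k)) \<noteq> top"
      using \<open>q \<ge> 0\<close> assms by (intro ennreal_suminf_neq_top) (auto simp: \<omega>_def)
    then show ?thesis by (simp add: top.not_eq_extremum)
  qed
  finally show ?thesis .
qed

text \<open>Translating by \<open>y\<close> moves the singularity to the origin and the ball into
  \<open>ball 0 (2 * r)\<close>. The bound obtained does not depend on \<open>y\<close>.\<close>

lemma nn_integral_norm_diff_powr_ball_le: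
  fixes a y :: "'a::euclidean_space"
  assumes "y \<in> ball a r"
  shows "(\<integral>\<^sup>+ x. ennreal (1 / norm (x - y) powr s) * indicator (ball a r) x \<partial>lborel)
     \<le> (\<integral>\<^sup>+ x. ennreal (1 / norm x powr s) * indicator (ball (0::'a) (2 * r)) x \<partial>lborel)"
proof -
  have [measurable]: "ball a r \<in> sets borel" by simp
  have m: "(\<lambda>x. ennreal (1 / norm (x - y) powr s) * indicator (ball a r) x) \<in> borel_measurable borel"
    by measurable
  have "(\<integral>\<^sup>+ x. ennreal (1 / norm (x - y) powr s) * indicator (ball a r) x \<partial>lborel) =
     (\<integral>\<^sup>+ x. ennreal (1 / norm (x - y) powr s) * indicator (ball a r) x \<partial>distr lborel borel ((+) y))"
    by (simp only: lborel_distr_plus)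
  also have "\<dots> = (\<integral>\<^sup>+ x. ennreal (1 / norm x powr s) * indicator (ball a r) (y + x) \<partial>lborel)"
    using m by (subst nn_integral_distr) simp_all
  also have "\<dots> \<le> (\<integral>\<^sup>+ x. ennreal (1 / norm x powr s) * indicator (ball (0::'a) (2 * r)) x \<partial>lborel)"
  proof (intro nn_integral_mono mult_left_mono)
    fix x
    have "norm x < 2 * r" if "y + x \<in> ball a r"
    proof -
      have "norm x \<le> dist a (y + x) + dist a y"
        using dist_triangle[of "y + x" y a] by (simp add: dist_norm norm_minus_commute)
      then show ?thesis using that assms by simp
    qed
    then show "indicator (ball a r) (y + x) \<le> (indicator (ball 0 (2 * r)) x :: ennreal)"
      by (auto simp: indicator_def)
  qed auto
  finally show ?thesis .
qed

text \<open>The integral is split at \<open>ball a 2\<close>: on the far part the kernel is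
  dominated by the weight, and on the near part Tonelli reduces the claim to local integrability of
  the kernel. Without integrability the Bochner integral in \<open>riesz_potential\<close> would be
  0 by default, which would defeat a lower bound.\<close>

lemma AE_integrable_norm_powr_convolution:
  fixes a :: "'a::euclidean_space" and f :: "'a \<Rightarrow> real" and s :: real
  assumes s: "0 < s" "s < DIM('a)"
    and f: "f \<in> borel_measurable lebesgue" "\<And>x. f x \<ge> 0"
    and w: "integrable lebesgue (\<lambda>x. f x * (1 + norm x) powr (- s))"
  shows "AE x in lebesgue. x \<in> ball a 1 \<longrightarrow> integrable lebesgue (\<lambda>y. f y / norm (x - y) powr s)"
proof -
  \<comment> \<open>This constant serves twice: \<open>1 + norm y\<close> is at most
    \<open>3 + norm a\<close> on \<open>ball a 2\<close>, and at most
    \<open>(3 + norm a) * norm (x - y)\<close> outside it when \<open>x\<close> is in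
    \<open>ball a 1\<close>.\<close>
  define D where "D = (3 + norm a) powr s"
  \<comment> \<open>Tonelli is applied to \<open>lborel\<close>, so \<open>f\<close> is replaced by
    a Borel representative; its absolute value \<open>v\<close> is nonnegative everywhere.\<close>
  obtain v0 where v0: "v0 \<in> borel_measurable lborel" "AE x in lborel. f x = v0 x"
    using completion_ex_borel_measurable_real[OF f(1)] by auto
  define v where "v x = \<bar>v0 x\<bar>" for x
  have v[measurable]: "v \<in> borel_measurable borel" using v0 by (simp add: v_def[abs_def])
  have vf: "AE x in lborel. f x = v x"
    using v0(2) by eventually_elim (metis f(2) v_def abs_of_nonneg)
  have vw: "integrable lborel (\<lambda>x. v x * (1 + norm x) powr (- s))"
  proof -
    have "integrable lebesgue (\<lambda>x. v x * (1 + norm x) powr (- s))"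
      by (rule integrable_cong_AE_imp[OF w])
        (auto intro!: measurable_completion AE_completion eventually_mono[OF vf])
    then show ?thesis by (subst (asm) integrable_completion) auto
  qed
  then have vw_fin: "(\<integral>\<^sup>+ x. ennreal (v x * (1 + norm x) powr (- s)) \<partial>lborel) < \<infinity>"
    unfolding integrable_iff_bounded by (simp add: v_def abs_mult)
  \<comment> \<open>Radius 4 is twice the radius of \<open>ball a 2\<close>, so \<open>J\<close>
    bounds the inner integral for every \<open>y\<close> in that ball.\<close>
  define J where "J = (\<integral>\<^sup>+ x. ennreal (1 / norm x powr s) * indicator (ball (0::'a) 4) x \<partial>lborel)"
  have J: "J < \<infinity>" unfolding J_def by (rule nn_integral_norm_powr_ball_finite) (use s in auto)
  have wD: "1 \<le> D * (1 + norm y) powr (- s)" if "y \<in> ball a 2" for y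
  proof -
    have "1 + norm y \<le> 3 + norm a"
      using that norm_triangle_ineq2[of y a] by (simp add: dist_norm norm_minus_commute)
    then have "(1 + norm y) powr s \<le> D" unfolding D_def using s by (intro powr_mono2) auto
    moreover have "(1 + norm y) powr s > 0" by (simp add: add_pos_nonneg powr_gt_zero less_imp_neq[symmetric])
    ultimately show ?thesis by (simp add: powr_minus field_simps)
  qed
  have far: "1 / norm (x - y) powr s \<le> D * (1 + norm y) powr (- s)"
    if "x \<in> ball a 1" "y \<notin> ball a 2" for x y
  proof -
    have 1: "1 \<le> norm (x - y)"
      using that dist_triangle[of a y x] by (simp add: dist_norm norm_minus_commute)
    have "norm y \<le> norm (x - y) + norm x" by norm
    moreover have "norm x \<le> norm a + 1" using that norm_triangle_ineq2[of x a] by (simp add: dist_norm norm_minus_commute)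
    moreover have "norm (x - y) * (3 + norm a) \<ge> norm (x - y) + (2 + norm a)"
      using mult_right_mono[OF 1, of "2 + norm a"] by (simp add: algebra_simps)
    ultimately have "1 + norm y \<le> (3 + norm a) * norm (x - y)" by (simp add: mult.commute)
    then have "(1 + norm y) powr s \<le> ((3 + norm a) * norm (x - y)) powr s"
      using s by (intro powr_mono2) auto
    also have "\<dots> = D * norm (x - y) powr s" by (simp add: D_def powr_mult)
    finally have "(1 + norm y) powr s \<le> D * norm (x - y) powr s" .
    moreover have "(1 + norm y) powr s > 0" "norm (x - y) powr s > 0"
      using 1 add_pos_nonneg[of 1 "norm y"] by (auto simp: powr_gt_zero)
    ultimately show ?thesis by (simp add: powr_minus field_simps)
  qed
  have D0: "D \<ge> 0" by (simp add: D_def)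
  \<comment> \<open>The near part. Both variables are cut off to the same ball, as the translation
    bound requires.\<close>
  define g where "g x y = ennreal (v y / norm (x - y) powr s) * indicator (ball a 2) y * indicator (ball a 2) x" for x y
  have [measurable]: "ball a 2 \<in> sets borel" by simp
  have g_meas[measurable]: "case_prod g \<in> borel_measurable (lborel \<Otimes>\<^sub>M lborel)"
    unfolding g_def by measurable
  have "(\<integral>\<^sup>+ x. \<integral>\<^sup>+ y. g x y \<partial>lborel \<partial>lborel) = (\<integral>\<^sup>+ y. \<integral>\<^sup>+ x. g x y \<partial>lborel \<partial>lborel)"
    by (rule lborel_pair.Fubini'[symmetric]) (rule g_meas)
  also have "\<dots> \<le> (\<integral>\<^sup>+ y. ennreal (D * (v y * (1 + norm y) powr (- s))) * J \<partial>lborel)"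
  proof (intro nn_integral_mono)
    fix y
    show "(\<integral>\<^sup>+ x. g x y \<partial>lborel) \<le> ennreal (D * (v y * (1 + norm y) powr (- s))) * J"
    proof (cases "y \<in> ball a 2")
      case True
      have "(\<integral>\<^sup>+ x. g x y \<partial>lborel) = (\<integral>\<^sup>+ x. ennreal (v y) * (ennreal (1 / norm (x - y) powr s) * indicator (ball a 2) x) \<partial>lborel)"
        using True by (intro nn_integral_cong) (simp add: g_def v_def mult.assoc[symmetric] flip: ennreal_mult)
      also have "\<dots> = ennreal (v y) * (\<integral>\<^sup>+ x. ennreal (1 / norm (x - y) powr s) * indicator (ball a 2) x \<partial>lborel)"
        by (intro nn_integral_cmult) auto
      also have "\<dots> \<le> ennreal (v y) * J"
        using nn_integral_norm_diff_powr_ball_le[OF True, of s] by (intro mult_left_mono) (auto simp: J_def)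
      also have "\<dots> \<le> ennreal (D * (v y * (1 + norm y) powr (- s))) * J"
        using mult_left_mono[OF wD[OF True], of "v y"]
        by (intro mult_right_mono ennreal_leI) (auto simp: v_def mult_ac)
      finally show ?thesis .
    next
      case False
      then show ?thesis by (simp add: g_def)
    qed
  qed
  also have "\<dots> = ennreal D * (\<integral>\<^sup>+ y. ennreal (v y * (1 + norm y) powr (- s)) \<partial>lborel) * J"
    by (simp add: nn_integral_multc nn_integral_cmult ennreal_mult'[OF D0])
  also have "\<dots> < \<infinity>" using vw_fin J by (simp add: ennreal_mult_less_top)
  finally have "(\<integral>\<^sup>+ x. \<integral>\<^sup>+ y. g x y \<partial>lborel \<partial>lborel) < \<infinity>" .
  then have "AE x in lborel. (\<integral>\<^sup>+ y. g x y \<partial>lborel) \<noteq> \<infinity>"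
    by (intro nn_integral_PInf_AE) (auto intro!: lborel.borel_measurable_nn_integral g_meas)
  then have "AE x in lborel. x \<in> ball a 1 \<longrightarrow> integrable lebesgue (\<lambda>y. f y / norm (x - y) powr s)"
  proof eventually_elim
    case (elim x)
    show ?case
    proof
      assume x: "x \<in> ball a 1"
      have "(\<integral>\<^sup>+ y. ennreal (v y / norm (x - y) powr s) \<partial>lborel) \<le>
         (\<integral>\<^sup>+ y. g x y + ennreal (D * (v y * (1 + norm y) powr (- s))) \<partial>lborel)"
      proof (intro nn_integral_mono)
        fix y
        show "ennreal (v y / norm (x - y) powr s) \<le> g x y + ennreal (D * (v y * (1 + norm y) powr (- s)))"
        proof (cases "y \<in> ball a 2")
          case True
          then show ?thesis using x by (simp add: g_def)
        next
          case False
          then show ?thesis using mult_left_mono[OF far[OF x False], of "v y"]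
            by (simp add: g_def v_def mult_ac ennreal_leI)
        qed
      qed
      also have "\<dots> = (\<integral>\<^sup>+ y. g x y \<partial>lborel) + (\<integral>\<^sup>+ y. ennreal (D * (v y * (1 + norm y) powr (- s))) \<partial>lborel)"
        by (intro nn_integral_add) (auto simp: g_def)
      also have "(\<integral>\<^sup>+ y. ennreal (D * (v y * (1 + norm y) powr (- s))) \<partial>lborel) =
          ennreal D * (\<integral>\<^sup>+ y. ennreal (v y * (1 + norm y) powr (- s)) \<partial>lborel)"
        by (simp add: nn_integral_cmult ennreal_mult'[OF D0])
      also have "(\<integral>\<^sup>+ y. g x y \<partial>lborel) + \<dots> < \<infinity>"
        using elim vw_fin by (auto simp: ennreal_mult_less_top top.not_eq_extremum)
      finally have "(\<integral>\<^sup>+ y. ennreal (v y / norm (x - y) powr s) \<partial>lborel) < \<infinity>" .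
      then have "integrable lborel (\<lambda>y. v y / norm (x - y) powr s)"
        by (intro integrableI_bounded) (measurable, simp add: v_def)
      then have "integrable lebesgue (\<lambda>y. v y / norm (x - y) powr s)"
        by (subst integrable_completion) auto
      then show "integrable lebesgue (\<lambda>y. f y / norm (x - y) powr s)"
        using f(1) vf
        by (elim integrable_cong_AE_imp)
          (auto intro!: borel_measurable_divide AE_completion intro: measurable_completion elim!: eventually_mono)
    qed
  qed
  then show ?thesis by (rule AE_completion)
qed

text \<open>The factor of the kernel that does not depend on the point; the type argument carries
  the dimension.\<close>

definition riesz_const :: "real \<Rightarrow> 'a::euclidean_space itself \<Rightarrow> real" where
  "riesz_const \<alpha> _ = Gamma ((real DIM('a) - \<alpha>) / 2) / (Gamma (\<alpha> / 2) * pi powr (real DIM('a) / 2) * 2 powr \<alpha>)"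

lemma riesz_const_pos: "0 < \<alpha> \<Longrightarrow> \<alpha> < real DIM('a) \<Longrightarrow> riesz_const \<alpha> TYPE('a::euclidean_space) > 0"
  by (simp add: riesz_const_def Gamma_real_pos)

lemma riesz_kernel_eq:
  "riesz_kernel \<alpha> (x::'a::euclidean_space) = riesz_const \<alpha> TYPE('a) / norm x powr (real DIM('a) - \<alpha>)"
  by (simp add: riesz_kernel_def riesz_const_def)

text \<open>Over \<open>K\<close> the kernel is at least its value at distance \<open>R\<close>; the
  rest of the integral is nonnegative and is discarded. The bound holds almost everywhere because it
  needs an integrable integrand.\<close>

lemma AE_riesz_potential_ge:
  fixes a :: "'a::euclidean_space" and f :: "'a \<Rightarrow> real" and \<alpha> R :: real
  assumes \<alpha>: "0 < \<alpha>" "\<alpha> < DIM('a)"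
    and f: "f \<in> borel_measurable lebesgue" "\<And>x. f x \<ge> 0"
    and w: "integrable lebesgue (\<lambda>x. f x * (1 + norm x) powr (- (real DIM('a) - \<alpha>)))"
    and K: "set_integrable lebesgue K f"
    and r: "r \<le> 1" and R: "\<And>x y. x \<in> ball a r \<Longrightarrow> y \<in> K \<Longrightarrow> x \<noteq> y \<and> norm (x - y) \<le> R"
  shows "AE x in lebesgue. x \<in> ball a r \<longrightarrow>
      riesz_const \<alpha> TYPE('a) / R powr (real DIM('a) - \<alpha>) * (LINT y:K|lebesgue. f y) \<le> riesz_potential \<alpha> f x"
proof -
  let ?s = "real DIM('a) - \<alpha>" and ?C = "riesz_const \<alpha> TYPE('a)"
  have "AE x in lebesgue. x \<in> ball a 1 \<longrightarrow> integrable lebesgue (\<lambda>y. f y / norm (x - y) powr ?s)"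
    using AE_integrable_norm_powr_convolution[OF _ _ f w, of a] \<alpha> by simp
  then show ?thesis
  proof eventually_elim
    case (elim x)
    show ?case
    proof
      assume x: "x \<in> ball a r"
      have C: "?C > 0" using \<alpha> by (rule riesz_const_pos)
      have i: "integrable lebesgue (\<lambda>y. riesz_kernel \<alpha> (x - y) * f y)"
        using integrable_mult_right[of ?C lebesgue "\<lambda>y. f y / norm (x - y) powr ?s"] elim x r
        by (auto simp: riesz_kernel_eq)
      have "?C / R powr ?s * (LINT y:K|lebesgue. f y) = (LINT y|lebesgue. ?C / R powr ?s * (indicator K y * f y))"
        by (simp add: set_lebesgue_integral_def)
      also have "\<dots> \<le> riesz_potential \<alpha> f x"
        unfolding riesz_potential_def
      proof (rule integral_mono[OF _ i])
        show "integrable lebesgue (\<lambda>y. ?C / R powr ?s * (indicator K y * f y))"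
          using K by (intro integrable_mult_right) (simp add: set_integrable_def)
        fix y
        show "?C / R powr ?s * (indicator K y * f y) \<le> riesz_kernel \<alpha> (x - y) * f y"
        proof (cases "y \<in> K")
          case True
          \<comment> \<open>Here \<open>x \<noteq> y\<close> matters: at the origin the kernel has
            the default value 0 and the bound would fail.\<close>
          with R[OF x, of y] have "norm (x - y) > 0" "norm (x - y) \<le> R" "R > 0"
            by (auto intro: less_le_trans[of _ "norm (x - y)"])
          then have "?C / R powr ?s \<le> riesz_kernel \<alpha> (x - y)"
            unfolding riesz_kernel_eq using C \<alpha>
            by (intro divide_left_mono powr_mono2) auto
          from mult_right_mono[OF this f(2)[of y]] show ?thesis using True by simp
        next
          case False
          then show ?thesis using C f(2) by (simp add: riesz_kernel_eq)
        qed
      qed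
      finally show "?C / R powr ?s * (LINT y:K|lebesgue. f y) \<le> riesz_potential \<alpha> f x" .
    qed
  qed
qed

section \<open>Testing with the bump function\<close>

lemma test_function_continuous: "test_function f \<Longrightarrow> continuous_on UNIV f"
  unfolding test_function_def by (metis continuously_differentiable.simps(1))

text \<open>A continuous function with compact support is bounded. Only continuity is assumed, so
  that the lemma also covers the product of \<open>V\<close> with a test function.\<close>

lemma integrable_scaleR_compact_support:
  fixes g :: "'a::euclidean_space \<Rightarrow> 'b::euclidean_space" and f :: "'a \<Rightarrow> real"
  assumes g: "locally_integrable g" and f: "continuous_on UNIV f" "compact (closure {x. f x \<noteq> 0})"
  shows "integrable lebesgue (\<lambda>x. f x *\<^sub>R g x)"
proof -
  let ?K = "closure {x. f x \<noteq> 0}"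
  have i: "integrable lebesgue (\<lambda>x. indicator ?K x *\<^sub>R g x)"
    using g f(2) by (simp add: locally_integrable_def set_integrable_def)
  have "compact (f ` ?K)" using f by (intro compact_continuous_image continuous_on_subset[OF f(1)]) auto
  then obtain B where "\<forall>y\<in>f ` ?K. norm y \<le> B"
    using compact_imp_bounded[of "f ` ?K"] unfolding bounded_iff by blast
  then have B: "norm (f x) \<le> B" if "x \<in> ?K" for x
    using that by simp
  have eq: "f x *\<^sub>R g x = f x *\<^sub>R (indicator ?K x *\<^sub>R g x)" for x
    using closure_subset[of "{x. f x \<noteq> 0}"] by (auto simp: indicator_def)
  have fm: "f \<in> borel_measurable lebesgue"
    using borel_measurable_continuous_onI[OF f(1)] by (intro measurable_completion) simp
  show ?thesis
  proof (rule Bochner_Integration.integrable_bound)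
    show "integrable lebesgue (\<lambda>x. B *\<^sub>R (indicator ?K x *\<^sub>R g x))"
      using i by (rule integrable_scaleR_right)
    show "(\<lambda>x. f x *\<^sub>R g x) \<in> borel_measurable lebesgue"
      unfolding eq by (intro borel_measurable_scaleR fm borel_measurable_integrable[OF i])
    show "AE x in lebesgue. norm (f x *\<^sub>R g x) \<le> norm (B *\<^sub>R (indicator ?K x *\<^sub>R g x))"
    proof (intro AE_I2)
      fix x
      show "norm (f x *\<^sub>R g x) \<le> norm (B *\<^sub>R (indicator ?K x *\<^sub>R g x))"
      proof (cases "x \<in> ?K")
        case True
        then have "norm (f x) \<le> \<bar>B\<bar>" using B[of x] by simp
        then show ?thesis using True by (simp add: mult_right_mono)
      next
        case False
        then show ?thesis using eq[of x] by auto
      qed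
    qed
  qed
qed

lemma integrable_test_function_scaleR:
  fixes g :: "'a::euclidean_space \<Rightarrow> 'b::euclidean_space"
  assumes "test_function f" "locally_integrable g"
  shows "integrable lebesgue (\<lambda>x. f x *\<^sub>R g x)"
  using assms integrable_scaleR_compact_support test_function_continuous
  by (auto simp: test_function_def)

section \<open>Moving both derivatives onto the test function\<close>

lemma grad_inner_Basis: "b \<in> Basis \<Longrightarrow> grad f x \<bullet> b = partial b f x"
  by (simp add: grad_def partial_def)

text \<open>Each \<open>partial b \<phi>\<close> is itself a test function. Testing the weak
  gradient with it, taking the component along \<open>b\<close> and summing over \<open>b\<close>
  produces the Laplacian of \<open>\<phi>\<close>.\<close>

lemma integral_weak_gradient_inner_grad:
  fixes u :: "'a::euclidean_space \<Rightarrow> real"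
  assumes g: "has_weak_gradient u g" and \<phi>: "test_function \<phi>"
  shows "integrable lebesgue (\<lambda>x. g x \<bullet> grad \<phi> x)"
    and "integrable lebesgue (\<lambda>x. u x * (\<Sum>b\<in>Basis. partial b (partial b \<phi>) x))"
    and "(\<integral>x. g x \<bullet> grad \<phi> x \<partial>lebesgue) = - (\<integral>x. u x * (\<Sum>b\<in>Basis. partial b (partial b \<phi>) x) \<partial>lebesgue)"
proof -
  have u: "locally_integrable u" and gi: "locally_integrable g" using g by (auto simp: has_weak_gradient_def)
  have test1: "test_function (partial b \<phi>)" if "b \<in> Basis" for b
    using \<phi> that by (rule test_function_partial)
  have i1: "integrable lebesgue (\<lambda>x. partial b \<phi> x *\<^sub>R g x)" if "b \<in> Basis" for b
    using test1[OF that] gi by (rule integrable_test_function_scaleR)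
  have i2: "integrable lebesgue (\<lambda>x. u x * partial c (partial b \<phi>) x)" if "b \<in> Basis" "c \<in> Basis" for b c
    using integrable_test_function_scaleR[OF test_function_partial[OF test1[OF that(1)] that(2)] u]
    by (simp add: mult.commute)
  have part: "integrable lebesgue (\<lambda>x. partial b \<phi> x * (g x \<bullet> b)) \<and>
      (\<integral>x. partial b \<phi> x * (g x \<bullet> b) \<partial>lebesgue) = - (\<integral>x. u x * partial b (partial b \<phi>) x \<partial>lebesgue)"
    if b: "b \<in> Basis" for b
  proof -
    \<comment> \<open>Integrability permits taking the inner product with \<open>b\<close> inside
      the vector-valued integral.\<close>
    have i3: "integrable lebesgue (\<lambda>x. u x *\<^sub>R grad (partial b \<phi>) x)"
      using i2[OF b] unfolding grad_def scaleR_sum_right scaleR_scaleR partial_def[of _ "partial b \<phi>", symmetric]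
      by (intro Bochner_Integration.integrable_sum integrable_scaleR_left) auto
    have "(\<integral>x. u x *\<^sub>R grad (partial b \<phi>) x \<partial>lebesgue) = - (\<integral>x. partial b \<phi> x *\<^sub>R g x \<partial>lebesgue)"
      using g test1[OF b] by (simp add: has_weak_gradient_def)
    then have "(\<integral>x. u x *\<^sub>R grad (partial b \<phi>) x \<partial>lebesgue) \<bullet> b = - ((\<integral>x. partial b \<phi> x *\<^sub>R g x \<partial>lebesgue) \<bullet> b)"
      by simp
    then have "(\<integral>x. (u x *\<^sub>R grad (partial b \<phi>) x) \<bullet> b \<partial>lebesgue) = - (\<integral>x. (partial b \<phi> x *\<^sub>R g x) \<bullet> b \<partial>lebesgue)"
      by (simp only: integral_inner_left i3 i1[OF b])
    then show ?thesis
      using integrable_inner_left[OF i1[OF b], of b] by (simp add: grad_inner_Basis[OF b])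
  qed
  have eq: "g x \<bullet> grad \<phi> x = (\<Sum>b\<in>Basis. partial b \<phi> x * (g x \<bullet> b))" for x
    by (simp add: grad_def partial_def inner_sum_right)
  show "integrable lebesgue (\<lambda>x. g x \<bullet> grad \<phi> x)"
    unfolding eq using part by (intro Bochner_Integration.integrable_sum) auto
  show "integrable lebesgue (\<lambda>x. u x * (\<Sum>b\<in>Basis. partial b (partial b \<phi>) x))"
    unfolding sum_distrib_left using i2 by (intro Bochner_Integration.integrable_sum) auto
  show "(\<integral>x. g x \<bullet> grad \<phi> x \<partial>lebesgue) = - (\<integral>x. u x * (\<Sum>b\<in>Basis. partial b (partial b \<phi>) x) \<partial>lebesgue)"
    unfolding eq sum_distrib_left using part i2
    by (simp add: Bochner_Integration.integral_sum sum_negf)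
qed

text \<open>Comparison with the bump function: testing the equation with it and bounding its Laplacian
  from below by a multiple of itself leaves the integral of \<open>u\<close> times the bump on both sides.\<close>

lemma positive_weak_solution_local_bound:
  fixes u V :: "'a::euclidean_space \<Rightarrow> real" and \<epsilon> r m v :: real
  assumes sol: "positive_weak_solution \<alpha> V \<epsilon> u" and u: "u \<in> H1_loc"
    and V: "continuous_on UNIV V" and \<epsilon>: "\<epsilon> > 0" and r: "r > 0"
    and m: "AE x in lebesgue. x \<in> ball a r \<longrightarrow> m \<le> riesz_potential \<alpha> (\<lambda>y. \<bar>u y\<bar>\<^sup>2) x"
    and v: "\<And>x. x \<in> ball a r \<Longrightarrow> x \<noteq> a \<Longrightarrow> V x \<le> v"
  shows "\<epsilon> powr (- \<alpha>) * m \<le> \<epsilon>\<^sup>2 * ((2 * real DIM('a) + 1) * (real DIM('a) + 6) ^ 4 / r\<^sup>2) + v"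
proof -
  define \<phi> where "\<phi> = bump a r"
  define Q where "Q = riesz_potential \<alpha> (\<lambda>y. \<bar>u y\<bar>\<^sup>2)"
  define c where "c = (2 * real DIM('a) + 1) * (real DIM('a) + 6) ^ 4 / r\<^sup>2"
  define e where "e = \<epsilon> powr (- \<alpha>)"
  let ?\<Delta> = "\<lambda>x. \<Sum>b\<in>Basis. partial b (partial b \<phi>) x"
  have \<phi>: "test_function \<phi>" unfolding \<phi>_def using r by (rule bump_test_function)
  have e: "e > 0" using \<epsilon> by (simp add: e_def)
  have \<phi>0: "\<phi> x \<ge> 0" for x by (simp add: \<phi>_def bump_nonneg)
  have supp: "\<phi> x > 0 \<longleftrightarrow> x \<in> ball a r" for x unfolding \<phi>_def using r by (rule bump_pos_iff)
  have supp0: "\<phi> x = 0" if "x \<notin> ball a r" for x using supp[of x] \<phi>0[of x] that by simp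
  \<comment> \<open>\<open>weak_grad\<close> is a choice; it is a weak gradient because membership
    in \<open>H1_loc\<close> provides one.\<close>
  have g: "has_weak_gradient u (weak_grad u)"
    using u someI_ex[of "has_weak_gradient u"] by (auto simp: H1_loc_def weak_grad_def)
  then have ul: "locally_integrable u" by (simp add: has_weak_gradient_def)
  have upos: "AE x in lebesgue. u x > 0" using sol by (simp add: positive_weak_solution_def)
  have iu: "integrable lebesgue (\<lambda>x. u x * \<phi> x)"
    using integrable_test_function_scaleR[OF \<phi> ul] by (simp add: mult.commute)
  have iV: "integrable lebesgue (\<lambda>x. V x * u x * \<phi> x)"
  proof -
    have "closure {x. V x * \<phi> x \<noteq> 0} \<subseteq> closure {x. \<phi> x \<noteq> 0}" by (intro closure_mono) auto
    then have "compact (closure {x. V x * \<phi> x \<noteq> 0})"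
      using \<phi> compact_Int_closed[OF _ closed_closure] unfolding test_function_def by (metis Int_absorb1)
    then have "integrable lebesgue (\<lambda>x. (V x * \<phi> x) *\<^sub>R u x)"
      using ul V test_function_continuous[OF \<phi>]
      by (intro integrable_scaleR_compact_support) (auto intro: continuous_on_mult)
    then show ?thesis by (simp add: mult_ac)
  qed
  have iQ: "integrable lebesgue (\<lambda>x. e * (Q x * u x * \<phi> x))"
  proof -
    have "locally_integrable (\<lambda>x. e * (Q x * u x))"
      using sol by (simp add: positive_weak_solution_def weak_solution_def e_def Q_def)
    from integrable_test_function_scaleR[OF \<phi> this] show ?thesis by (simp add: mult_ac)
  qed
  define I where "I = (\<integral>x. u x * \<phi> x \<partial>lebesgue)"
  have nonneg: "AE x in lebesgue. 0 \<le> u x * \<phi> x"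
    using upos by eventually_elim (simp add: \<phi>0)
  \<comment> \<open>Otherwise \<open>u x * \<phi> x\<close> would vanish almost everywhere; as both
    factors are positive almost everywhere on the ball, the ball would be a null set.\<close>
  have "I \<noteq> 0"
  proof
    assume "I = 0"
    then have "AE x in lebesgue. u x * \<phi> x = 0"
      using integral_nonneg_eq_0_iff_AE[OF iu nonneg] by (simp add: I_def)
    with upos have "AE x in lebesgue. x \<notin> ball a r"
    proof eventually_elim
      case (elim x)
      then show ?case using supp[of x] by auto
    qed
    then have "negligible (ball a r)"
      using AE_iff_null_sets[of "ball a r" lebesgue] by (simp add: negligible_iff_null_sets del: mem_ball)
    then show False using open_not_negligible[of "ball a r"] r by simp
  qed
  moreover have "I \<ge> 0" unfolding I_def by (rule integral_nonneg_AE) (rule nonneg)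
  ultimately have I: "I > 0" by simp
  \<comment> \<open>The chain starts from the nonlocal term: \<open>m\<close> bounds the potential
    below on the ball, and off the ball \<open>\<phi>\<close> vanishes.\<close>
  have "(e * m) * I = (\<integral>x. e * (m * (u x * \<phi> x)) \<partial>lebesgue)"
    by (simp add: I_def)
  also have "\<dots> \<le> (\<integral>x. e * (Q x * u x * \<phi> x) \<partial>lebesgue)"
  proof (rule integral_mono_AE[OF _ iQ])
    show "integrable lebesgue (\<lambda>x. e * (m * (u x * \<phi> x)))" using iu by simp
    show "AE x in lebesgue. e * (m * (u x * \<phi> x)) \<le> e * (Q x * u x * \<phi> x)"
      using m nonneg
    proof eventually_elim
      case (elim x)
      then show ?case
        using e supp0[of x] mult_right_mono[of m "Q x" "u x * \<phi> x"]
        by (cases "x \<in> ball a r") (auto simp: Q_def mult.assoc)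
    qed
  qed
  also have "\<dots> = (\<integral>x. \<epsilon>\<^sup>2 * (weak_grad u x \<bullet> grad \<phi> x) + V x * u x * \<phi> x \<partial>lebesgue)"
    using sol \<phi> by (simp add: positive_weak_solution_def weak_solution_def e_def Q_def)
  also have "\<dots> = \<epsilon>\<^sup>2 * (\<integral>x. weak_grad u x \<bullet> grad \<phi> x \<partial>lebesgue) + (\<integral>x. V x * u x * \<phi> x \<partial>lebesgue)"
    using integral_weak_gradient_inner_grad(1)[OF g \<phi>] iV by simp
  also have "(\<integral>x. weak_grad u x \<bullet> grad \<phi> x \<partial>lebesgue) = (\<integral>x. - (u x * ?\<Delta> x) \<partial>lebesgue)"
    using integral_weak_gradient_inner_grad(3)[OF g \<phi>] by simp
  also have "\<dots> \<le> (\<integral>x. c * (u x * \<phi> x) \<partial>lebesgue)"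
  proof (rule integral_mono_AE)
    show "integrable lebesgue (\<lambda>x. - (u x * ?\<Delta> x))"
      using integral_weak_gradient_inner_grad(2)[OF g \<phi>] by simp
    show "integrable lebesgue (\<lambda>x. c * (u x * \<phi> x))" using iu by simp
    show "AE x in lebesgue. - (u x * ?\<Delta> x) \<le> c * (u x * \<phi> x)"
      using upos
    proof eventually_elim
      case (elim x)
      have "- (c * \<phi> x) \<le> ?\<Delta> x" using bump_laplacian_ge[OF r, of a x] by (simp add: \<phi>_def c_def)
      then show ?case using mult_left_mono[of "- (c * \<phi> x)" "?\<Delta> x" "u x"] elim by (simp add: mult_ac)
    qed
  qed
  also have "\<dots> = c * I" by (simp add: I_def)
  also have "(\<integral>x. V x * u x * \<phi> x \<partial>lebesgue) \<le> (\<integral>x. v * (u x * \<phi> x) \<partial>lebesgue)"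
  proof (rule integral_mono_AE[OF iV])
    show "integrable lebesgue (\<lambda>x. v * (u x * \<phi> x))" using iu by simp
    \<comment> \<open>The bound \<open>v\<close> says nothing about the centre, which is a null
      set.\<close>
    have "AE x in lebesgue. x \<noteq> a" by (rule AE_completion) (rule AE_lborel_singleton)
    then show "AE x in lebesgue. V x * u x * \<phi> x \<le> v * (u x * \<phi> x)"
      using nonneg
    proof eventually_elim
      case (elim x)
      then show ?case
        using supp0[of x] mult_right_mono[of "V x" v "u x * \<phi> x"] v[of x]
        by (cases "x \<in> ball a r") (auto simp: mult.assoc)
    qed
  qed
  also have "\<dots> = v * I" by (simp add: I_def)
  finally have "(e * m) * I \<le> (\<epsilon>\<^sup>2 * c + v) * I" using \<epsilon> by (simp add: algebra_simps)
  then show ?thesis using I by (simp add: e_def c_def)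
qed

section \<open>Scaling of the radius and conclusion\<close>

theorem theorem4:
  fixes \<alpha> \<epsilon>0 :: real
    and V :: "'a::euclidean_space \<Rightarrow> real"
    and a :: 'a
    and u :: "real \<Rightarrow> 'a \<Rightarrow> real"
    and K :: "'a set"
  assumes "0 < \<alpha>" "\<alpha> < real DIM('a)" "\<alpha> > real DIM('a) - 2"
    and "continuous_on UNIV V" "\<And>x. V x \<ge> 0"
    and "V \<in> o[at a](\<lambda>x. norm (x - a) powr (4 / (\<alpha> + 2 - real DIM('a)) - 2))"
    and "\<epsilon>0 > 0"
    and "\<And>\<epsilon>. \<epsilon> \<in> {0<..<\<epsilon>0} \<Longrightarrow>
           u \<epsilon> \<in> H1_loc \<inter> weighted_L2 (\<lambda>x. (1 + norm x) powr (- (real DIM('a) - \<alpha>)))"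
    and "\<And>\<epsilon>. \<epsilon> \<in> {0<..<\<epsilon>0} \<Longrightarrow> positive_weak_solution \<alpha> V \<epsilon> (u \<epsilon>)"
    and "compact K" "K \<subseteq> - {a}"
  shows "(\<lambda>\<epsilon>. LINT x:K|lebesgue. \<bar>u \<epsilon> x\<bar>\<^sup>2) \<in> o[at_right 0](\<lambda>\<epsilon>. \<epsilon> ^ DIM('a))"
proof -
  note \<alpha> = assms(1-3)
  define \<beta> where "\<beta> = \<alpha> + 2 - real DIM('a)"
  \<comment> \<open>The exponent in the assumption on \<open>V\<close>. It is positive because
    \<open>\<beta> < 2\<close>, and \<open>\<beta> / 2 * p = 2 - \<beta>\<close>.\<close>
  define p where "p = 4 / \<beta> - 2"
  define \<Lambda> where "\<Lambda> = (2 * real DIM('a) + 1) * (real DIM('a) + 6) ^ 4"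
  define M where "M \<epsilon> = (LINT x:K|lebesgue. \<bar>u \<epsilon> x\<bar>\<^sup>2)" for \<epsilon>
  have \<beta>: "0 < \<beta>" "\<beta> < 2" using \<alpha> by (auto simp: \<beta>_def)
  have p: "p > 0" using \<beta> by (simp add: p_def field_simps)
  have \<Lambda>: "\<Lambda> > 0" by (simp add: \<Lambda>_def add_pos_pos add_nonneg_pos)
  have "open (- K)" "a \<in> - K" using assms(10,11) by (auto intro: compact_imp_closed)
  then obtain r1 where r1: "r1 > 0" "ball a r1 \<subseteq> - K" using openE by blast
  \<comment> \<open>The ball must miss \<open>K\<close>, and the bound on the potential requires
    radius at most 1. That radius is also the summand 1 in \<open>R\<close> below.\<close>
  define r0 where "r0 = min r1 1"
  have r0: "r0 > 0" "r0 \<le> 1" "ball a r0 \<subseteq> - K" using r1 by (auto simp: r0_def)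
  obtain B where B: "B > 0" "K \<subseteq> ball a B"
    using bounded_subset_ballD[OF compact_imp_bounded[OF assms(10)]] by blast
  define R where "R = B + 1"
  have R: "x \<noteq> y \<and> norm (x - y) \<le> R" if "x \<in> ball a r" "y \<in> K" "r \<le> r0" for x y r
  proof -
    have x: "x \<in> ball a r0" using that by auto
    have "norm (x - y) \<le> dist a x + dist a y"
      using dist_triangle[of x y a] by (simp add: dist_norm norm_minus_commute)
    moreover have "dist a y < B" using B(2) that(2) by auto
    moreover have "dist a x < 1" using x r0(2) by simp
    ultimately have "norm (x - y) \<le> R" by (simp add: R_def)
    then show ?thesis using x r0(3) that(2) by blast
  qed
  define C where "C = riesz_const \<alpha> TYPE('a) / R powr (real DIM('a) - \<alpha>)"
  have C: "C > 0" using riesz_const_pos[OF \<alpha>(1,2)] B(1) by (simp add: C_def R_def)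
  \<comment> \<open>The radius \<open>r\<close> and the bound \<open>v\<close> stay free here; both
    will depend on \<open>\<epsilon>\<close>.\<close>
  have bound: "\<epsilon> powr (- \<alpha>) * (C * M \<epsilon>) \<le> \<epsilon>\<^sup>2 * (\<Lambda> / r\<^sup>2) + v"
    if "\<epsilon> \<in> {0<..<\<epsilon>0}" "0 < r" "r \<le> r0" and v: "\<And>x. x \<in> ball a r \<Longrightarrow> x \<noteq> a \<Longrightarrow> V x \<le> v" for \<epsilon> r v
  proof -
    have u: "u \<epsilon> \<in> H1_loc" "u \<epsilon> \<in> weighted_L2 (\<lambda>x. (1 + norm x) powr (- (real DIM('a) - \<alpha>)))"
      using assms(8)[OF that(1)] by auto
    have meas: "(\<lambda>y. \<bar>u \<epsilon> y\<bar>\<^sup>2) \<in> borel_measurable lebesgue"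
      using u(2) unfolding weighted_L2_def by (auto intro: borel_measurable_power borel_measurable_abs)
    have "AE x in lebesgue. x \<in> ball a r \<longrightarrow> C * M \<epsilon> \<le> riesz_potential \<alpha> (\<lambda>y. \<bar>u \<epsilon> y\<bar>\<^sup>2) x"
      unfolding C_def M_def
    proof (rule AE_riesz_potential_ge[OF \<alpha>(1,2) meas])
      show "set_integrable lebesgue K (\<lambda>y. \<bar>u \<epsilon> y\<bar>\<^sup>2)"
        using u(1) assms(10) by (simp add: H1_loc_def locally_square_integrable_def locally_integrable_def)
    qed (use u(2) r0(2) that(3) R in \<open>auto simp: weighted_L2_def\<close>)
    then show ?thesis
      unfolding \<Lambda>_def
      using positive_weak_solution_local_bound[OF assms(9)[OF that(1)] u(1) assms(4)] that by simp
  qed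
  have "M \<in> o[at_right 0](\<lambda>\<epsilon>. \<epsilon> ^ DIM('a))"
  proof (rule landau_o.smallI)
    fix c :: real assume c: "c > 0"
    \<comment> \<open>With \<open>r \<epsilon> = \<epsilon> powr (\<beta> / 2) / \<delta>\<close>
      the two error terms are \<open>\<Lambda> * \<delta>\<^sup>2\<close> and
      \<open>\<kappa> / \<delta> powr p\<close> times \<open>\<epsilon> powr (2 - \<beta>)\<close>.
      The constants make each coefficient equal to \<open>c * C / 2\<close>.\<close>
    define \<delta> where "\<delta> = sqrt (c * C / (2 * \<Lambda>))"
    define \<kappa> where "\<kappa> = c * C / 2 * \<delta> powr p"
    have \<delta>: "\<delta> > 0" "\<delta>\<^sup>2 = c * C / (2 * \<Lambda>)" using c C \<Lambda> by (simp_all add: \<delta>_def)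
    have \<kappa>: "\<kappa> > 0" using c C \<delta>(1) by (simp add: \<kappa>_def)
    have "eventually (\<lambda>x. norm (V x) \<le> \<kappa> * norm (norm (x - a) powr p)) (at a)"
      using landau_o.smallD[OF assms(6) \<kappa>] by (simp add: p_def \<beta>_def)
    then obtain \<rho> where \<rho>: "\<rho> > 0"
      "\<forall>x. x \<noteq> a \<and> dist x a < \<rho> \<longrightarrow> \<bar>V x\<bar> \<le> \<kappa> * norm (x - a) powr p"
      unfolding eventually_at by auto
    define r where "r \<epsilon> = \<epsilon> powr (\<beta> / 2) / \<delta>" for \<epsilon>
    have "((\<lambda>\<epsilon>. \<epsilon> powr (\<beta> / 2)) \<longlongrightarrow> 0) (at_right (0::real))"
      by (rule tendsto_zero_powrI[where b = "\<beta> / 2"])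
        (use \<beta> in \<open>auto intro: eventually_at_right_less tendsto_ident_at eventually_mono[OF eventually_at_right_less]\<close>)
    then have "(r \<longlongrightarrow> 0) (at_right 0)"
      unfolding r_def[abs_def] by (intro tendsto_divide_zero)
    then have "eventually (\<lambda>\<epsilon>. r \<epsilon> < min r0 \<rho>) (at_right 0)"
      by (rule order_tendstoD) (use r0 \<rho> in simp)
    moreover have "eventually (\<lambda>\<epsilon>. \<epsilon> \<in> {0<..<\<epsilon>0}) (at_right 0)"
      using assms(7) by (rule eventually_at_right_real)
    ultimately show "eventually (\<lambda>\<epsilon>. norm (M \<epsilon>) \<le> c * norm (\<epsilon> ^ DIM('a))) (at_right 0)"
    proof eventually_elim
      case (elim \<epsilon>)
      then have \<epsilon>: "\<epsilon> > 0" and r: "r \<epsilon> > 0" using \<delta> by (auto simp: r_def)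
      have "V x \<le> \<kappa> * r \<epsilon> powr p" if "x \<in> ball a (r \<epsilon>)" "x \<noteq> a" for x
      proof -
        have x: "dist x a < r \<epsilon>" using that by (simp add: dist_commute)
        then have "V x \<le> \<kappa> * norm (x - a) powr p" using \<rho>(2)[rule_format, of x] that elim by simp
        \<comment> \<open>Monotonicity of the power uses that \<open>p\<close> is positive.\<close>
        also have "\<dots> \<le> \<kappa> * r \<epsilon> powr p"
          using x \<kappa> p by (intro mult_left_mono powr_mono2) (auto simp: dist_norm)
        finally show ?thesis .
      qed
      from bound[OF elim(2) r _ this] elim(1)
      have "\<epsilon> powr (- \<alpha>) * (C * M \<epsilon>) \<le> \<epsilon>\<^sup>2 * (\<Lambda> / (r \<epsilon>)\<^sup>2) + \<kappa> * r \<epsilon> powr p" by simp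
      also have "\<epsilon>\<^sup>2 * (\<Lambda> / (r \<epsilon>)\<^sup>2) = c * C / 2 * \<epsilon> powr (2 - \<beta>)"
      proof -
        have "(r \<epsilon>)\<^sup>2 = \<epsilon> powr \<beta> / \<delta>\<^sup>2"
          using \<epsilon> by (simp add: r_def power_divide power2_eq_square flip: powr_add)
        moreover have "\<epsilon> powr (2 - \<beta>) = \<epsilon>\<^sup>2 / \<epsilon> powr \<beta>"
          using \<epsilon> powr_realpow[of \<epsilon> 2] by (simp add: powr_diff)
        ultimately show ?thesis using \<delta> \<Lambda> by (simp add: mult_ac)
      qed
      also have "\<kappa> * r \<epsilon> powr p = c * C / 2 * \<epsilon> powr (2 - \<beta>)"
      proof -
        have "\<beta> / 2 * p = 2 - \<beta>" using \<beta> by (simp add: p_def field_simps)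
        then have "r \<epsilon> powr p = \<epsilon> powr (2 - \<beta>) / \<delta> powr p"
          by (simp only: r_def powr_divide powr_powr)
        then show ?thesis using \<delta>(1) by (simp add: \<kappa>_def)
      qed
      finally have "\<epsilon> powr (- \<alpha>) * (C * M \<epsilon>) \<le> c * C * \<epsilon> powr (2 - \<beta>)" by (simp add: mult_ac)
      \<comment> \<open>Clearing the negative power leaves the exponent
        \<open>\<alpha> + (2 - \<beta>)\<close>, which is the dimension.\<close>
      then have "\<epsilon> powr \<alpha> * (\<epsilon> powr (- \<alpha>) * (C * M \<epsilon>)) \<le> \<epsilon> powr \<alpha> * (c * C * \<epsilon> powr (2 - \<beta>))"
        by (intro mult_left_mono) auto
      also have "\<epsilon> powr \<alpha> * (\<epsilon> powr (- \<alpha>) * (C * M \<epsilon>)) = C * M \<epsilon>"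
        using \<epsilon> by (simp add: powr_minus)
      also have "\<epsilon> powr \<alpha> * (c * C * \<epsilon> powr (2 - \<beta>)) = C * (c * \<epsilon> powr (\<alpha> + (2 - \<beta>)))"
        by (simp add: powr_add)
      also have "\<alpha> + (2 - \<beta>) = real DIM('a)" by (simp add: \<beta>_def)
      also have "\<epsilon> powr real DIM('a) = \<epsilon> ^ DIM('a)" using \<epsilon> by (rule powr_realpow)
      finally have "M \<epsilon> \<le> c * \<epsilon> ^ DIM('a)" using C by simp
      moreover have "M \<epsilon> \<ge> 0" unfolding M_def set_lebesgue_integral_def
        by (intro Bochner_Integration.integral_nonneg) auto
      ultimately show ?case using \<epsilon> by simp
    qed
  qed
  then show ?thesis by (simp add: M_def[abs_def])
qed

end
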